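(* Let $\Delta = d+1\ge 3$ be an integer and $\delta\in(0,1)$, and let $\lambda=(1-\delta)\lambda_c(\Delta)$ with $\lambda_c(\Delta)=\frac{(\Delta-1)^{\Delta-1}}{(\Delta-2)^{\Delta}}$. For $h\ge1$, let $T_{\Delta,h}$ be the rooted $\Delta$-regular tree truncated at depth $h$, and let $C_{\Delta,h,\lambda}$ be the optimal (smallest) $\ell_\infty$-spectral independence constant of the hardcore Gibbs distribution $\mu_{T_{\Delta,h},\lambda}$. Then $$\lim_{h\to\infty} C_{\Delta,h,\lambda} = \frac{1+\hat x}{1-d\hat x},$$ where $\hat x$ is the unique fixed point in $[0,1]$ of $F_{d,\lambda}(x)=\frac{\lambda(1-x)^d}{1+\lambda(1-x)^d}$.
   Context: $T_{\Delta,h}$ is the tree in which the root has $\Delta$ children, every non-root vertex at depth less than $h$ has $\Delta-1$ children, and all leaves are at depth $h$. The hardcore model on a graph $G$ with fugacity $\lambda>0$ is the distribution $\mu_{G,\lambda}(\sigma)\propto\lambda^{|\sigma|}$ over independent sets $\sigma$ of $G$, viewed as a distribution over $\{0,1\}^V$. For a distribution $\mu$ over $\{0,1\}^n$, let $A_\mu$ be the set of coordinates $i$ with $\Pr_\mu[\sigma_i=0]>0$ and $\Pr_\mu[\sigma_i=1]>0$; for $i,j\in A_\mu$ the influence is $\Psi_\mu(i,j)=\Pr_\mu[\sigma_j=1\mid\sigma_i=1]-\Pr_\mu[\sigma_j=1\mid\sigma_i=0]$. A pinning is a partial configuration $\tau\in\{0,1\}^\Lambda$ with $\Pr_\mu[\sigma_\Lambda=\tau]>0$,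 and $\mu^\tau$ is the conditional distribution. $\mu$ satisfies $\ell_\infty$-spectral independence with constant $C$ if for every pinning $\tau$, $\max_{i\in A_{\mu^\tau}}\sum_{j\in A_{\mu^\tau}}|\Psi_{\mu^\tau}(i,j)|\le C$; the optimal constant is the supremum over pinnings $\tau$ of this maximum. *)

theory Defs
  imports "HOL-Probability.Probability"
begin

section \<open>The hardcore model\<close>

text \<open>A finite simple graph is given by its vertex set \<open>V\<close> and its set \<open>E\<close> of two-element edges.\<close>

definition indep_sets_of :: "'v set \<Rightarrow> 'v set set \<Rightarrow> 'v set set" where
  "indep_sets_of V E = {S. S \<subseteq> V \<and> (\<forall>e\<in>E. \<not> e \<subseteq> S)}"

definition hardcore_Z :: "'v set \<Rightarrow> 'v set set \<Rightarrow> real \<Rightarrow> real" where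
  "hardcore_Z V E lam = (\<Sum>S\<in>indep_sets_of V E. lam ^ card S)"

definition hardcore_set_pmf :: "'v set \<Rightarrow> 'v set set \<Rightarrow> real \<Rightarrow> 'v set pmf" where
  "hardcore_set_pmf V E lam =
     embed_pmf (\<lambda>S. if S \<in> indep_sets_of V E then lam ^ card S / hardcore_Z V E lam else 0)"

text \<open>The same distribution on configurations; \<open>True\<close> encodes 1, and coordinates outside
  \<open>V\<close> are constantly \<open>False\<close>.\<close>

definition hardcore :: "'v set \<Rightarrow> 'v set set \<Rightarrow> real \<Rightarrow> ('v \<Rightarrow> bool) pmf" where
  "hardcore V E lam = map_pmf (\<lambda>S v. v \<in> S) (hardcore_set_pmf V E lam)"

lemma finite_indep_sets_of: "finite V \<Longrightarrow> finite (indep_sets_of V E)"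
  by (rule finite_subset[of _ "Pow V"]) (auto simp: indep_sets_of_def)

lemma hardcore_Z_pos:
  assumes "finite V" "{} \<notin> E" "lam > 0"
  shows "hardcore_Z V E lam > 0"
  unfolding hardcore_Z_def
proof (rule sum_pos2[where i = "{}"])
  show "{} \<in> indep_sets_of V E"
    using assms by (auto simp: indep_sets_of_def)
qed (use assms finite_indep_sets_of in auto)

lemma pmf_hardcore_set_pmf:
  assumes "finite V" "{} \<notin> E" "lam > 0"
  shows "pmf (hardcore_set_pmf V E lam) S =
    (if S \<in> indep_sets_of V E then lam ^ card S / hardcore_Z V E lam else 0)"
  unfolding hardcore_set_pmf_def
proof (rule pmf_embed_pmf)
  let ?I = "indep_sets_of V E" and ?Z = "hardcore_Z V E lam"
  let ?f = "\<lambda>S. if S \<in> ?I then lam ^ card S / ?Z else 0"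
  have Z: "?Z > 0" by (rule hardcore_Z_pos[OF assms])
  show nonneg: "0 \<le> ?f S" for S using Z assms by auto
  have fin: "finite ?I" using assms(1) by (rule finite_indep_sets_of)
  have "(\<integral>\<^sup>+ S. ennreal (?f S) \<partial>count_space UNIV) = (\<Sum>S\<in>?I. ennreal (?f S))"
    by (rule nn_integral_count_space'[OF fin]) auto
  also have "\<dots> = ennreal (\<Sum>S\<in>?I. ?f S)"
    by (rule sum_ennreal) (rule nonneg)
  also have "(\<Sum>S\<in>?I. ?f S) = (\<Sum>S\<in>?I. lam ^ card S) / ?Z"
    by (simp add: sum_divide_distrib)
  also have "\<dots> = 1" using Z by (simp add: hardcore_Z_def)
  finally show "(\<integral>\<^sup>+ S. ennreal (?f S) \<partial>count_space UNIV) = 1" by simp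
qed


section \<open>Spectral independence in the infinity norm\<close>

text \<open>Throughout, \<open>V\<close> is the finite set of coordinates of the distribution \<open>\<mu>\<close>.\<close>

definition active :: "'i set \<Rightarrow> ('i \<Rightarrow> bool) pmf \<Rightarrow> 'i set" where
  "active V \<mu> = {i \<in> V. \<P>(\<sigma> in measure_pmf \<mu>. \<not> \<sigma> i) > 0 \<and> \<P>(\<sigma> in measure_pmf \<mu>. \<sigma> i) > 0}"

definition influence :: "('i \<Rightarrow> bool) pmf \<Rightarrow> 'i \<Rightarrow> 'i \<Rightarrow> real" where
  "influence \<mu> i j =
     \<P>(\<sigma> in measure_pmf \<mu>. \<sigma> j \<bar> \<sigma> i) - \<P>(\<sigma> in measure_pmf \<mu>. \<sigma> j \<bar> \<not> \<sigma> i)"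

text \<open>A partial configuration on \<open>\<Lambda>\<close> is a total function \<open>\<tau>\<close> whose values outside \<open>\<Lambda>\<close> are ignored.\<close>

definition agrees :: "'i set \<Rightarrow> ('i \<Rightarrow> bool) \<Rightarrow> ('i \<Rightarrow> bool) set" where
  "agrees \<Lambda> \<tau> = {\<sigma>. \<forall>i\<in>\<Lambda>. \<sigma> i = \<tau> i}"

definition pinning :: "'i set \<Rightarrow> ('i \<Rightarrow> bool) pmf \<Rightarrow> 'i set \<Rightarrow> ('i \<Rightarrow> bool) \<Rightarrow> bool" where
  "pinning V \<mu> \<Lambda> \<tau> \<longleftrightarrow> \<Lambda> \<subseteq> V \<and> measure_pmf.prob \<mu> (agrees \<Lambda> \<tau>) > 0"

definition pinned :: "('i \<Rightarrow> bool) pmf \<Rightarrow> 'i set \<Rightarrow> ('i \<Rightarrow> bool) \<Rightarrow> ('i \<Rightarrow> bool) pmf" where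
  "pinned \<mu> \<Lambda> \<tau> = cond_pmf \<mu> (agrees \<Lambda> \<tau>)"

text \<open>If no coordinate is active (e.g. everything is pinned), the maximum is over the empty set
  and is taken to be 0.\<close>

definition max_influence :: "'i set \<Rightarrow> ('i \<Rightarrow> bool) pmf \<Rightarrow> real" where
  "max_influence V \<mu> =
     (if active V \<mu> = {} then 0
      else (MAX i\<in>active V \<mu>. \<Sum>j\<in>active V \<mu>. \<bar>influence \<mu> i j\<bar>))"

definition linf_spectrally_independent :: "'i set \<Rightarrow> ('i \<Rightarrow> bool) pmf \<Rightarrow> real \<Rightarrow> bool" where
  "linf_spectrally_independent V \<mu> C \<longleftrightarrow>
     (\<forall>\<Lambda> \<tau>. pinning V \<mu> \<Lambda> \<tau> \<longrightarrow> max_influence V (pinned \<mu> \<Lambda> \<tau>) \<le> C)"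

definition linf_SI_constant :: "'i set \<Rightarrow> ('i \<Rightarrow> bool) pmf \<Rightarrow> real" where
  "linf_SI_constant V \<mu> =
     (SUP (\<Lambda>, \<tau>) \<in> {(\<Lambda>, \<tau>). pinning V \<mu> \<Lambda> \<tau>}. max_influence V (pinned \<mu> \<Lambda> \<tau>))"

lemma abs_influence_le_1: "\<bar>influence \<mu> i j\<bar> \<le> 1"
proof -
  have "0 \<le> cond_prob (measure_pmf \<mu>) P Q \<and> cond_prob (measure_pmf \<mu>) P Q \<le> 1" for P Q
    by (auto simp: cond_prob_def divide_le_eq_1 less_le
        intro!: measure_pmf.finite_measure_mono)
  from this[of "\<lambda>\<sigma>. \<sigma> j" "\<lambda>\<sigma>. \<sigma> i"] this[of "\<lambda>\<sigma>. \<sigma> j" "\<lambda>\<sigma>. \<not> \<sigma> i"]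
  show ?thesis by (auto simp: influence_def abs_le_iff)
qed

lemma max_influence_le_card:
  assumes "finite V"
  shows "max_influence V \<mu> \<le> card V"
proof -
  have fin: "finite (active V \<mu>)" and sub: "active V \<mu> \<subseteq> V"
    using assms by (auto simp: active_def)
  have "(\<Sum>j\<in>active V \<mu>. \<bar>influence \<mu> i j\<bar>) \<le> card V" for i
  proof -
    have "(\<Sum>j\<in>active V \<mu>. \<bar>influence \<mu> i j\<bar>) \<le> (\<Sum>j\<in>active V \<mu>. 1)"
      by (intro sum_mono abs_influence_le_1)
    also have "\<dots> \<le> card V"
      using card_mono[OF assms sub] by simp
    finally show ?thesis .
  qed
  then show ?thesis using fin by (auto simp: max_influence_def)
qed

text \<open>The supremum is indeed the smallest admissible constant.\<close>

lemma linf_spectrally_independent_iff: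
  assumes "finite V"
  shows "linf_spectrally_independent V \<mu> C \<longleftrightarrow> linf_SI_constant V \<mu> \<le> C"
proof -
  let ?P = "{(\<Lambda>, \<tau>). pinning V \<mu> \<Lambda> \<tau>}"
  let ?f = "\<lambda>(\<Lambda>, \<tau>). max_influence V (pinned \<mu> \<Lambda> \<tau>)"
  have "({}, \<lambda>_. False) \<in> ?P"
    by (auto simp: pinning_def agrees_def)
  then have ne: "?P \<noteq> {}" by blast
  have bdd: "bdd_above (?f ` ?P)"
    by (rule bdd_aboveI[where M = "real (card V)"]) (auto simp: max_influence_le_card[OF assms])
  show ?thesis
    unfolding linf_SI_constant_def cSUP_le_iff[OF ne bdd]
    by (auto simp: linf_spectrally_independent_def)
qed


section \<open>Truncated regular trees\<close>

text \<open>A vertex is the list of child indices on the path from the root \<open>[]\<close>; its depth is its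
  length.\<close>

definition tree_verts :: "nat \<Rightarrow> nat \<Rightarrow> nat list set" where
  "tree_verts \<Delta> h =
     {w. length w \<le> h \<and> (\<forall>k<length w. w ! k < (if k = 0 then \<Delta> else \<Delta> - 1))}"

definition tree_edges :: "nat \<Rightarrow> nat \<Rightarrow> nat list set set" where
  "tree_edges \<Delta> h = {{w, w @ [c]} | w c. w @ [c] \<in> tree_verts \<Delta> h}"

lemma finite_tree_verts: "finite (tree_verts \<Delta> h)"
proof (rule finite_subset)
  show "tree_verts \<Delta> h \<subseteq> {w. set w \<subseteq> {..<\<Delta>} \<and> length w \<le> h}"
    by (fastforce simp: tree_verts_def in_set_conv_nth split: if_splits)
qed (simp add: finite_lists_length_le)

definition lambda_c :: "nat \<Rightarrow> real" where
  "lambda_c \<Delta> = (real \<Delta> - 1) ^ (\<Delta> - 1) / (real \<Delta> - 2) ^ \<Delta>"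

definition hardcore_F :: "nat \<Rightarrow> real \<Rightarrow> real \<Rightarrow> real" where
  "hardcore_F d lam x = lam * (1 - x) ^ d / (1 + lam * (1 - x) ^ d)"

end

theory Submission
  imports Defs
begin

text \<open>
  Deleting the neighbours of a vertex \<open>v\<close> one at a time expresses the marginal \<open>x\<close> of \<open>v\<close> through marginals
  \<open>x\<^sub>u\<close> of its neighbours in smaller induced subgraphs, \<open>x = \<rho> / (1 + \<rho>)\<close> with \<open>\<rho> = \<lambda> \<Prod>\<^sub>u (1 - x\<^sub>u)\<close>, and
  bounds the total influence by \<open>T \<le> 1 + \<Sum>\<^sub>u x\<^sub>u T\<^sub>u\<close>. With \<open>K = 1 / (1 - d x\<^sub>*)\<close>, where \<open>x\<^sub>*\<close> is the fixed
  point, the bounds \<open>T \<le> K\<close> and \<open>x T \<le> K x\<^sub>*\<close> propagate through this recursion: the first is immediate, the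
  second is AM-GM. Hence every graph of maximal degree \<open>d + 1\<close> has constant at most \<open>1 + (d + 1) K x\<^sub>*\<close>,
  since pinnings only pass to induced subgraphs. On the tree without pinnings the recursion for the sum of
  influences of the root weighted with alternating signs is exact, and its marginals are iterates of \<open>F\<close>,
  which converge to \<open>x\<^sub>*\<close> because \<open>F\<close> is a contraction in the variable \<open>artanh (sqrt x)\<close>.
\<close>

section \<open>The AM-GM inequality and contracting recursions\<close>

lemma prod_le_power_if_mean_le:
  fixes f :: "'a \<Rightarrow> real"
  assumes I: "finite I" and nonneg: "\<And>i. i \<in> I \<Longrightarrow> 0 \<le> f i"
    and mean: "(\<Sum>i\<in>I. f i) \<le> real (card I) * w"
  shows "(\<Prod>i\<in>I. f i) \<le> w ^ card I"
proof (cases "I = {}")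
  case False
  then have card: "0 < card I" using I by (simp add: card_gt_0_iff)
  have "(\<Prod>i\<in>I. f i) powr (1 / card I) \<le> (\<Sum>i\<in>I. f i / card I)"
    using I False nonneg by (rule arith_geom_mean)
  also have "\<dots> \<le> w"
    using mean card by (simp add: field_simps flip: sum_divide_distrib)
  finally have "((\<Prod>i\<in>I. f i) powr (1 / card I)) ^ card I \<le> w ^ card I"
    by (intro power_mono) auto
  moreover have "((\<Prod>i\<in>I. f i) powr (1 / card I)) ^ card I = (\<Prod>i\<in>I. f i)"
    using card nonneg by (simp add: powr_powr prod_nonneg flip: powr_realpow')
  ultimately show ?thesis by simp
qed simp

text \<open>This is AM-GM for the \<open>d + 1\<close> numbers \<open>1 - x i\<close> (\<open>i \<in> I\<close>), \<open>1\<close> (repeated \<open>d - card I\<close> times) and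
  the last factor, whose mean is \<open>w\<close>.\<close>

lemma prod_one_minus_times_sum_le_power:
  fixes x :: "'a \<Rightarrow> real"
  assumes I: "finite I" "card I \<le> d" and x_le_1: "\<And>i. i \<in> I \<Longrightarrow> x i \<le> 1" and w_nonneg: "0 \<le> w"
  shows "(\<Prod>i\<in>I. 1 - x i) * (w - real d * (1 - w) + (\<Sum>i\<in>I. x i)) \<le> w ^ Suc d"
proof -
  define t where "t = w - real d * (1 - w) + (\<Sum>i\<in>I. x i)"
  show ?thesis
  proof (cases "0 \<le> t")
    case False
    then have "(\<Prod>i\<in>I. 1 - x i) * t \<le> 0"
      using x_le_1 by (intro mult_nonneg_nonpos prod_nonneg) auto
    also have "0 \<le> w ^ Suc d" using w_nonneg by simp
    finally show ?thesis by (simp add: t_def)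
  next
    case True
    define m where "m = d - card I"
    let ?J = "I <+> {..<Suc m}"
      and ?f = "case_sum (\<lambda>i. 1 - x i) (\<lambda>j. if j = 0 then t else 1)"
    have card: "card ?J = Suc d" using I by (simp add: card_Plus m_def)
    have "(\<Sum>i\<in>?J. ?f i) = (\<Sum>i\<in>I. 1 - x i) + t + real m"
      using I(1) by (simp add: sum.Plus sum.lessThan_Suc_shift del: sum.lessThan_Suc)
    also have "\<dots> = real (card ?J) * w"
      unfolding card using I(2) by (simp add: sum_subtractf m_def t_def of_nat_diff algebra_simps)
    finally have "(\<Prod>i\<in>?J. ?f i) \<le> w ^ card ?J"
      using I(1) x_le_1 True by (intro prod_le_power_if_mean_le) auto
    moreover have "(\<Prod>i\<in>?J. ?f i) = (\<Prod>i\<in>I. 1 - x i) * t"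
      using I(1) by (simp add: prod.Plus prod.lessThan_Suc_shift del: prod.lessThan_Suc)
    ultimately show ?thesis by (simp only: card t_def)
  qed
qed

lemma contraction_iterates_tendsto:
  fixes f :: "'a::metric_space \<Rightarrow> 'a"
  assumes q: "0 \<le> q" "q < 1" and contr: "\<And>x y. dist (f x) (f y) \<le> q * dist x y" and fixed: "f p = p"
  shows "(\<lambda>n. (f ^^ n) x) \<longlonglongrightarrow> p"
proof -
  have "dist ((f ^^ n) x) p \<le> q ^ n * dist x p" for n
  proof (induction n)
    case (Suc n)
    have "dist ((f ^^ Suc n) x) p \<le> q * dist ((f ^^ n) x) p"
      using contr[of "(f ^^ n) x" p] by (simp add: fixed)
    also have "\<dots> \<le> q * (q ^ n * dist x p)"
      using Suc q(1) by (rule mult_left_mono)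
    finally show ?case by (simp add: mult.assoc)
  qed simp
  moreover have "(\<lambda>n. q ^ n * dist x p) \<longlonglongrightarrow> 0"
    using q by (intro tendsto_mult_left_zero LIMSEQ_power_zero) auto
  ultimately show ?thesis
    unfolding tendsto_dist_iff[of _ p] by (intro Lim_null_comparison[of "\<lambda>n. dist ((f ^^ n) x) p"]) auto
qed

lemma perturbed_contraction_tendsto_0:
  fixes e b :: "nat \<Rightarrow> real"
  assumes nonneg: "\<And>n. 0 \<le> e n" and q: "0 \<le> q" "q < 1"
    and rec: "eventually (\<lambda>n. e (Suc n) \<le> q * e n + b n) sequentially" and perturbation: "b \<longlonglongrightarrow> 0"
  shows "e \<longlonglongrightarrow> 0"
proof (rule order_tendstoI)
  fix r :: real assume r: "0 < r"
  define \<epsilon> where "\<epsilon> = r / 2"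
  have "eventually (\<lambda>n. b n < (1 - q) * \<epsilon>) sequentially"
    using perturbation by (rule order_tendstoD) (use q r in \<open>simp add: \<epsilon>_def\<close>)
  with rec have "eventually (\<lambda>n. e (Suc n) - \<epsilon> \<le> q * (e n - \<epsilon>)) sequentially"
    by eventually_elim (simp add: algebra_simps)
  then obtain N where step: "\<And>n. N \<le> n \<Longrightarrow> e (Suc n) - \<epsilon> \<le> q * (e n - \<epsilon>)"
    unfolding eventually_sequentially by blast
  have decay: "e (m + N) - \<epsilon> \<le> q ^ m * (e N - \<epsilon>)" for m
  proof (induction m)
    case (Suc m)
    have "e (Suc m + N) - \<epsilon> \<le> q * (e (m + N) - \<epsilon>)" using step[of "m + N"] by simp
    also have "\<dots> \<le> q * (q ^ m * (e N - \<epsilon>))" using Suc q(1) by (rule mult_left_mono)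
    finally show ?case by (simp add: mult.assoc)
  qed simp
  have "(\<lambda>m. q ^ m * (e N - \<epsilon>)) \<longlonglongrightarrow> 0"
    using q by (intro tendsto_mult_left_zero LIMSEQ_power_zero) auto
  then have "eventually (\<lambda>m. q ^ m * (e N - \<epsilon>) < \<epsilon>) sequentially"
    by (rule order_tendstoD) (use r in \<open>simp add: \<epsilon>_def\<close>)
  then have "eventually (\<lambda>m. e (m + N) < r) sequentially"
  proof eventually_elim
    case (elim m)
    then show ?case using decay[of m] by (simp add: \<epsilon>_def)
  qed
  then show "eventually (\<lambda>n. e n < r) sequentially"
    by (rule eventually_sequentially_seg[where P = "\<lambda>n. e n < r", THEN iffD1])
qed (use nonneg in \<open>auto intro: always_eventually less_le_trans\<close>)

lemma affine_recursion_tendsto: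
  fixes a y :: "nat \<Rightarrow> real"
  assumes rec: "\<And>n. a (Suc n) = 1 + y n * a n" and lim: "y \<longlonglongrightarrow> l" and abs_less_1: "\<bar>l\<bar> < 1"
  shows "a \<longlonglongrightarrow> 1 / (1 - l)"
proof -
  let ?L = "1 / (1 - l)"
  define e where "e n = \<bar>a n - ?L\<bar>" for n
  obtain q where q: "\<bar>l\<bar> < q" "q < 1" using abs_less_1 dense by blast
  have "(\<lambda>n. \<bar>y n\<bar>) \<longlonglongrightarrow> \<bar>l\<bar>" using lim by (rule tendsto_rabs)
  then have "eventually (\<lambda>n. \<bar>y n\<bar> < q) sequentially" using q(1) by (rule order_tendstoD)
  then have "eventually (\<lambda>n. e (Suc n) \<le> q * e n + \<bar>(y n - l) * ?L\<bar>) sequentially"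
  proof eventually_elim
    case (elim n)
    have "a (Suc n) - ?L = y n * (a n - ?L) + (y n - l) * ?L"
      using abs_less_1 by (simp add: rec divide_simps) (simp add: algebra_simps)
    then have "e (Suc n) \<le> \<bar>y n\<bar> * e n + \<bar>(y n - l) * ?L\<bar>"
      unfolding e_def abs_mult[symmetric] by (simp only: abs_triangle_ineq)
    also have "\<bar>y n\<bar> * e n \<le> q * e n"
      using elim by (intro mult_right_mono) (auto simp: e_def)
    finally show ?case by simp
  qed
  moreover have "(\<lambda>n. \<bar>(y n - l) * ?L\<bar>) \<longlonglongrightarrow> 0"
    using lim by (intro tendsto_rabs_zero tendsto_mult_left_zero LIM_zero)
  ultimately have "e \<longlonglongrightarrow> 0"
    by (rule perturbed_contraction_tendsto_0[rotated 3]) (use q in \<open>auto simp: e_def\<close>)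
  then show ?thesis
    unfolding e_def by (simp only: tendsto_rabs_zero_iff LIM_zero_iff)
qed

section \<open>The recursion below the critical fugacity\<close>

lemma hardcore_F_eq_iff:
  assumes "0 < lam" "x \<le> 1"
  shows "hardcore_F d lam x = x \<longleftrightarrow> x = lam * (1 - x) ^ Suc d"
proof -
  have "0 < 1 + lam * (1 - x) ^ d" using assms by (intro add_pos_nonneg) auto
  then have "hardcore_F d lam x = x \<longleftrightarrow> lam * (1 - x) ^ d = x * (1 + lam * (1 - x) ^ d)"
    by (simp add: hardcore_F_def field_simps)
  then show ?thesis by (simp add: algebra_simps) linarith
qed

lemma hardcore_F_fixed_point_unique:
  assumes "0 < lam" "x \<le> 1" "y \<le> 1" "hardcore_F d lam x = x" "hardcore_F d lam y = y"
  shows "x = y"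
  using assms
proof (induction x y rule: linorder_wlog)
  case (le x y)
  have "lam * (1 - y) ^ Suc d \<le> lam * (1 - x) ^ Suc d"
    using le by (intro mult_left_mono power_mono) auto
  then show ?case
    using le hardcore_F_eq_iff[of lam x d] hardcore_F_eq_iff[of lam y d] by linarith
qed simp

lemma lambda_c_Suc: "lambda_c (Suc d) = real d ^ d / (real d - 1) ^ Suc d"
  by (simp add: lambda_c_def algebra_simps)

lemma lambda_c_pos: "2 \<le> d \<Longrightarrow> 0 < lambda_c (Suc d)"
  by (simp add: lambda_c_Suc)

lemma power_times_linear_le_inverse_lambda_c:
  assumes "2 \<le> d" "x \<le> 1"
  shows "(1 - x) ^ d * (real d ^ 2 * x - 1) \<le> 1 / lambda_c (Suc d)"
proof -
  define w where "w = (real d - 1) / real d"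
  have "w - real d * (1 - w) + real d * x = (real d ^ 2 * x - 1) / real d"
    using assms by (simp add: w_def field_simps power2_eq_square)
  then have "(1 - x) ^ d * (real d ^ 2 * x - 1) / real d \<le> w ^ Suc d"
    using prod_one_minus_times_sum_le_power[of "{..<d}" d "\<lambda>_. x" w] assms by (simp add: w_def)
  then have "(1 - x) ^ d * (real d ^ 2 * x - 1) \<le> w ^ Suc d * real d"
    using assms by (simp only: pos_divide_le_eq of_nat_0_less_iff)
  also have "\<dots> = 1 / lambda_c (Suc d)"
    using assms by (simp add: w_def lambda_c_Suc power_divide)
  finally show ?thesis .
qed

lemma tanh_sq_le_1: "tanh x ^ 2 \<le> 1" for x :: real
  using tanh_real_bounds[of x] by (simp add: abs_square_le_1 abs_le_iff)

text \<open>The substitution \<open>x = tanh\<^sup>2 \<theta>\<close> turns \<open>hardcore_F\<close> into a contraction: the derivative at \<open>\<theta>\<close> of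
  the conjugated map is \<open>- d tanh \<theta> tanh \<theta>'\<close>, where \<open>\<theta>'\<close> is the image of \<open>\<theta>\<close>.\<close>

definition hardcore_angle :: "nat \<Rightarrow> real \<Rightarrow> real \<Rightarrow> real" where
  "hardcore_angle d lam \<theta> = arsinh (sqrt lam / cosh \<theta> ^ d)"

lemma tanh_sq_hardcore_angle:
  assumes "0 \<le> lam"
  shows "tanh (hardcore_angle d lam \<theta>) ^ 2 = hardcore_F d lam (tanh \<theta> ^ 2)"
proof -
  have "1 - tanh \<theta> ^ 2 = 1 / cosh \<theta> ^ 2"
    by (simp add: tanh_def power_divide sinh_square_eq diff_divide_distrib)
  then have "lam * (1 - tanh \<theta> ^ 2) ^ d = (sqrt lam / cosh \<theta> ^ d) ^ 2"
    using assms by (simp add: power_divide mult.commute flip: power_mult)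
  also have "\<dots> = sinh (hardcore_angle d lam \<theta>) ^ 2"
    by (simp add: hardcore_angle_def)
  finally show ?thesis
    by (simp add: hardcore_F_def tanh_def[of "hardcore_angle d lam \<theta>"] power_divide cosh_square_eq add.commute)
qed

lemma hardcore_angle_has_derivative:
  "(hardcore_angle d lam has_field_derivative
      - real d * tanh \<theta> * tanh (hardcore_angle d lam \<theta>)) (at \<theta> within A)"
proof -
  let ?s = "sqrt lam / cosh \<theta> ^ d"
  have "cosh (hardcore_angle d lam \<theta>) = sqrt (?s ^ 2 + 1)"
    by (simp add: hardcore_angle_def cosh_arsinh_real)
  then have tanh_eq: "tanh (hardcore_angle d lam \<theta>) = ?s / sqrt (?s ^ 2 + 1)"
    by (simp add: tanh_def) (simp add: hardcore_angle_def)
  have "(cosh has_field_derivative sinh \<theta>) (at \<theta> within A)"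
    by (auto intro!: derivative_eq_intros)
  from DERIV_power[OF this, of d]
  have "((\<lambda>\<theta>. cosh \<theta> ^ d) has_field_derivative real d * tanh \<theta> * cosh \<theta> ^ d) (at \<theta> within A)"
    by (cases d) (simp_all add: tanh_def)
  from DERIV_divide[OF DERIV_const[of "sqrt lam"] this]
  have "((\<lambda>\<theta>. sqrt lam / cosh \<theta> ^ d) has_field_derivative - real d * tanh \<theta> * ?s) (at \<theta> within A)"
    by (simp add: mult_ac)
  from DERIV_chain2[OF arsinh_real_has_field_derivative this]
  show ?thesis unfolding hardcore_angle_def[abs_def] tanh_eq[unfolded hardcore_angle_def]
    by (simp add: mult_ac)
qed

locale subcritical_fugacity =
  fixes d :: nat and lam :: real
  assumes degree_ge_2: "2 \<le> d" and fugacity_pos: "0 < lam" and less_lambda_c: "lam < lambda_c (Suc d)"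
begin

definition contraction_rate :: real where
  "contraction_rate = sqrt ((lam / lambda_c (Suc d) + lam) / (1 + lam))"

lemma contraction_rate_nonneg: "0 \<le> contraction_rate"
  using fugacity_pos lambda_c_pos[OF degree_ge_2] by (simp add: contraction_rate_def)

lemma contraction_rate_less_1: "contraction_rate < 1"
  using fugacity_pos lambda_c_pos[OF degree_ge_2] less_lambda_c by (simp add: contraction_rate_def)

lemma arg_times_hardcore_F_le:
  assumes x: "0 \<le> x" "x \<le> 1"
  shows "real d ^ 2 * x * hardcore_F d lam x \<le> contraction_rate ^ 2"
proof -
  define \<rho> r where "\<rho> = lam * (1 - x) ^ d" and "r = lam / lambda_c (Suc d)"
  have "(1 - x) ^ d \<le> 1" using x by (intro power_le_one) auto
  then have \<rho>: "0 \<le> \<rho>" "\<rho> \<le> lam" using fugacity_pos x by (auto simp: \<rho>_def mult_left_le)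
  have ratio: "0 < r" "r < 1"
    using fugacity_pos lambda_c_pos[OF degree_ge_2] less_lambda_c by (auto simp: r_def)
  have "lam * ((1 - x) ^ d * (real d ^ 2 * x - 1)) \<le> lam * (1 / lambda_c (Suc d))"
    using fugacity_pos power_times_linear_le_inverse_lambda_c[OF degree_ge_2 x(2)]
    by (intro mult_left_mono) auto
  then have "real d ^ 2 * x * \<rho> \<le> r + \<rho>" by (simp add: \<rho>_def r_def algebra_simps)
  then have "real d ^ 2 * x * \<rho> / (1 + \<rho>) \<le> (r + \<rho>) / (1 + \<rho>)"
    using \<rho> by (intro divide_right_mono) auto
  also have "\<dots> = 1 - (1 - r) / (1 + \<rho>)" using \<rho> by (simp add: field_simps)
  also have "\<dots> \<le> 1 - (1 - r) / (1 + lam)" using \<rho> ratio by (simp add: frac_le)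
  also have "\<dots> = (r + lam) / (1 + lam)" using fugacity_pos by (simp add: field_simps)
  finally show ?thesis
    using ratio fugacity_pos by (simp add: hardcore_F_def \<rho>_def r_def contraction_rate_def)
qed

lemma dist_hardcore_angle_le:
  "dist (hardcore_angle d lam \<theta>) (hardcore_angle d lam \<phi>) \<le> contraction_rate * dist \<theta> \<phi>"
proof -
  let ?D = "\<lambda>t. - real d * tanh t * tanh (hardcore_angle d lam t)"
  have "norm (?D t) \<le> contraction_rate" for t
  proof -
    have "real d ^ 2 * tanh t ^ 2 * hardcore_F d lam (tanh t ^ 2) \<le> contraction_rate ^ 2"
      by (intro arg_times_hardcore_F_le tanh_sq_le_1) auto
    then have "norm (?D t) ^ 2 \<le> contraction_rate ^ 2"
      using fugacity_pos by (simp add: power_mult_distrib tanh_sq_hardcore_angle)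
    then show ?thesis using contraction_rate_nonneg by (rule power2_le_imp_le)
  qed
  then show ?thesis
    unfolding dist_norm
    by (intro field_differentiable_bound[where S = UNIV and f' = ?D] hardcore_angle_has_derivative) auto
qed

lemma ex_fixed_point_hardcore_F_iterates_tendsto:
  "\<exists>x\<in>{0..1}. hardcore_F d lam x = x \<and> (\<lambda>n. (hardcore_F d lam ^^ n) 0) \<longlonglongrightarrow> x"
proof -
  let ?G = "hardcore_angle d lam"
  obtain \<theta> where \<theta>: "?G \<theta> = \<theta>"
    using banach_fix_type[OF contraction_rate_nonneg contraction_rate_less_1, of ?G] dist_hardcore_angle_le
    by blast
  have "(\<lambda>n. (?G ^^ n) 0) \<longlonglongrightarrow> \<theta>"
    using contraction_rate_nonneg contraction_rate_less_1 dist_hardcore_angle_le \<theta>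
    by (rule contraction_iterates_tendsto)
  then have "(\<lambda>n. tanh ((?G ^^ n) 0) ^ 2) \<longlonglongrightarrow> tanh \<theta> ^ 2"
    by (intro tendsto_intros) auto
  moreover have "tanh ((?G ^^ n) 0) ^ 2 = (hardcore_F d lam ^^ n) 0" for n
    using fugacity_pos by (induction n) (auto simp: tanh_sq_hardcore_angle)
  moreover have "hardcore_F d lam (tanh \<theta> ^ 2) = tanh \<theta> ^ 2"
    using tanh_sq_hardcore_angle[of lam d \<theta>] fugacity_pos by (simp add: \<theta>)
  ultimately show ?thesis by (intro bexI[of _ "tanh \<theta> ^ 2"]) (auto simp: tanh_sq_le_1)
qed

lemma ex1_hardcore_F_fixed_point: "\<exists>!x. x \<in> {0..1} \<and> hardcore_F d lam x = x"
  using ex_fixed_point_hardcore_F_iterates_tendsto hardcore_F_fixed_point_unique[OF fugacity_pos]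
  by (auto intro!: ex_ex1I)

lemma hardcore_F_iterates_tendsto:
  assumes "x \<in> {0..1}" "hardcore_F d lam x = x"
  shows "(\<lambda>n. (hardcore_F d lam ^^ n) 0) \<longlonglongrightarrow> x"
  using ex_fixed_point_hardcore_F_iterates_tendsto ex1_hardcore_F_fixed_point assms by blast

end

locale stable_fixed_point =
  fixes d :: nat and lam xhat :: real
  assumes fugacity_pos: "0 < lam" and xhat_nonneg: "0 \<le> xhat" and xhat_less_1: "xhat < 1"
    and fixed_point: "hardcore_F d lam xhat = xhat" and stable: "real d * xhat < 1"
begin

lemma hardcore_recursion_times_sum_le:
  fixes x :: "'a \<Rightarrow> real"
  assumes I: "finite I" "card I \<le> d" and x_le_1: "\<And>i. i \<in> I \<Longrightarrow> x i \<le> 1"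
  defines "\<rho> \<equiv> lam * (\<Prod>i\<in>I. 1 - x i)"
  shows "\<rho> / (1 + \<rho>) * (1 + (\<Sum>i\<in>I. x i) / (1 - real d * xhat)) \<le> xhat / (1 - real d * xhat)"
proof -
  let ?s = "\<Sum>i\<in>I. x i" and ?gap = "1 - real d * xhat"
  have \<rho>: "0 \<le> \<rho>" using x_le_1 fugacity_pos by (auto simp: \<rho>_def intro!: mult_nonneg_nonneg prod_nonneg)
  have "(\<Prod>i\<in>I. 1 - x i) * (?gap - xhat + ?s) \<le> (1 - xhat) ^ Suc d"
    using prod_one_minus_times_sum_le_power[OF I x_le_1, where w = "1 - xhat"] xhat_less_1
    by (simp add: algebra_simps)
  then have "lam * ((\<Prod>i\<in>I. 1 - x i) * (?gap - xhat + ?s)) \<le> lam * (1 - xhat) ^ Suc d"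
    using fugacity_pos by (intro mult_left_mono) auto
  also have "\<dots> = xhat"
    using hardcore_F_eq_iff[of lam xhat d] fugacity_pos xhat_less_1 fixed_point by simp
  finally have "\<rho> * (?gap + ?s) \<le> xhat * (1 + \<rho>)"
    by (simp add: \<rho>_def algebra_simps)
  then have "\<rho> / (1 + \<rho>) * (?gap + ?s) \<le> xhat"
    using \<rho> by (simp add: divide_le_eq)
  then have "\<rho> / (1 + \<rho>) * (?gap + ?s) / ?gap \<le> xhat / ?gap"
    using stable by (intro divide_right_mono) auto
  also have "\<rho> / (1 + \<rho>) * (?gap + ?s) / ?gap = \<rho> / (1 + \<rho>) * (1 + ?s / ?gap)"
    using stable by (simp add: add_divide_distrib flip: times_divide_eq_right)
  finally show ?thesis .
qed

end

lemma (in subcritical_fugacity) stable_fixed_pointI: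
  assumes x: "x \<in> {0..1}" and fixed: "hardcore_F d lam x = x"
  shows "stable_fixed_point d lam x"
proof
  have "(real d * x) ^ 2 \<le> contraction_rate ^ 2"
    using arg_times_hardcore_F_le[of x] x fixed by (simp add: power_mult_distrib power2_eq_square mult_ac)
  then have "real d * x \<le> contraction_rate"
    using contraction_rate_nonneg by (rule power2_le_imp_le)
  then show "real d * x < 1" using contraction_rate_less_1 by linarith
  moreover have "1 * x \<le> real d * x"
    using x degree_ge_2 by (intro mult_right_mono) auto
  ultimately show "x < 1" by simp
qed (use x fixed fugacity_pos in auto)

section \<open>Pinning a hardcore model deletes vertices\<close>

lemma prob_cond_pmf:
  assumes "measure_pmf.prob p A > 0"
  shows "measure_pmf.prob (cond_pmf p A) B = measure_pmf.prob p (A \<inter> B) / measure_pmf.prob p A"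
proof -
  have ne: "set_pmf p \<inter> A \<noteq> {}"
    using assms by (metis less_irrefl measure_Int_set_pmf measure_empty inf_commute)
  have "measure_pmf.prob (cond_pmf p A) B = measure (uniform_measure (measure_pmf p) A) B"
    by (simp add: cond_pmf.rep_eq[OF ne])
  also have "\<dots> = measure_pmf.prob p (A \<inter> B) / measure_pmf.prob p A"
    using assms by (subst measure_uniform_measure) (auto simp: measure_pmf.emeasure_eq_measure)
  finally show ?thesis .
qed

lemma prob_minus_cond_prob_eq_influence:
  assumes "\<P>(\<sigma> in measure_pmf \<mu>. \<not> \<sigma> i) > 0"
  shows "\<P>(\<sigma> in measure_pmf \<mu>. \<sigma> j) - \<P>(\<sigma> in measure_pmf \<mu>. \<sigma> j \<bar> \<not> \<sigma> i) =
    \<P>(\<sigma> in measure_pmf \<mu>. \<sigma> i) * influence \<mu> i j"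
proof -
  let ?p = "\<lambda>P. measure_pmf.prob \<mu> {\<sigma>. P \<sigma>}"
  have split: "?p P = ?p (\<lambda>\<sigma>. P \<sigma> \<and> \<sigma> i) + ?p (\<lambda>\<sigma>. P \<sigma> \<and> \<not> \<sigma> i)" for P
    by (subst measure_pmf.finite_measure_Union[symmetric]) (auto intro!: arg_cong[where f = "measure \<mu>"])
  have total: "?p (\<lambda>\<sigma>. \<sigma> i) + ?p (\<lambda>\<sigma>. \<not> \<sigma> i) = 1"
    using split[of "\<lambda>_. True"] by simp
  have "?p (\<lambda>\<sigma>. \<sigma> j \<and> \<sigma> i) = 0" if "?p (\<lambda>\<sigma>. \<sigma> i) = 0"
    using that measure_pmf.finite_measure_mono[of "{\<sigma>. \<sigma> j \<and> \<sigma> i}" "{\<sigma>. \<sigma> i}" \<mu>]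
    by (simp add: subset_eq measure_le_0_iff)
  then have "?p (\<lambda>\<sigma>. \<sigma> i) * (?p (\<lambda>\<sigma>. \<sigma> j \<and> \<sigma> i) / ?p (\<lambda>\<sigma>. \<sigma> i)) = ?p (\<lambda>\<sigma>. \<sigma> j \<and> \<sigma> i)"
    by simp
  moreover have "?p (\<lambda>\<sigma>. \<sigma> i) * (?p (\<lambda>\<sigma>. \<sigma> j \<and> \<not> \<sigma> i) / ?p (\<lambda>\<sigma>. \<not> \<sigma> i)) =
      ?p (\<lambda>\<sigma>. \<sigma> j \<and> \<not> \<sigma> i) / ?p (\<lambda>\<sigma>. \<not> \<sigma> i) - ?p (\<lambda>\<sigma>. \<sigma> j \<and> \<not> \<sigma> i)"
    unfolding total[THEN eq_diff_eq[THEN iffD2]] using assms by (simp add: field_simps)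
  ultimately show ?thesis
    using split[of "\<lambda>\<sigma>. \<sigma> j"] by (simp add: influence_def cond_prob_def right_diff_distrib)
qed

lemma influence_map_pmf:
  assumes "\<And>\<sigma>. f \<sigma> i = \<sigma> i" "\<And>\<sigma>. f \<sigma> j = \<sigma> j"
  shows "influence (map_pmf f \<mu>) i j = influence \<mu> i j"
  using assms by (simp add: influence_def cond_prob_def vimage_def)

definition occupied :: "'i set \<Rightarrow> ('i \<Rightarrow> bool) \<Rightarrow> 'i set" where
  "occupied \<Lambda> \<tau> = {i \<in> \<Lambda>. \<tau> i}"

lemma mem_agrees_iff_Int_eq_occupied: "(\<lambda>v. v \<in> S) \<in> agrees \<Lambda> \<tau> \<longleftrightarrow> S \<inter> \<Lambda> = occupied \<Lambda> \<tau>"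
  by (auto simp: agrees_def occupied_def)

locale hardcore_graph =
  fixes E :: "'v set set" and lam :: real
  assumes card_edge: "e \<in> E \<Longrightarrow> card e = 2" and lam_pos: "0 < lam"
begin

abbreviation indep :: "'v set \<Rightarrow> 'v set set" where
  "indep U \<equiv> indep_sets_of U E"

abbreviation Z :: "'v set \<Rightarrow> real" where
  "Z U \<equiv> hardcore_Z U E lam"

abbreviation gibbs :: "'v set \<Rightarrow> ('v \<Rightarrow> bool) pmf" where
  "gibbs U \<equiv> hardcore U E lam"

definition nbrs :: "'v \<Rightarrow> 'v set" where
  "nbrs v = {u. {u, v} \<in> E}"

definition free_verts :: "'v set \<Rightarrow> 'v set \<Rightarrow> ('v \<Rightarrow> bool) \<Rightarrow> 'v set" where
  "free_verts V \<Lambda> \<tau> = V - \<Lambda> - (\<Union>u\<in>occupied \<Lambda> \<tau>. nbrs u)"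

lemma edgeE:
  assumes "e \<in> E"
  obtains u v where "e = {u, v}"
  using card_edge[OF assms] by (auto simp: card_2_iff)

lemma nbrs_sym: "u \<in> nbrs v \<longleftrightarrow> v \<in> nbrs u"
  by (simp add: nbrs_def insert_commute)

lemma nbrs_irrefl: "v \<notin> nbrs v"
  using card_edge[of "{v}"] by (auto simp: nbrs_def)

lemma free_verts_subset: "free_verts V \<Lambda> \<tau> \<subseteq> V"
  by (auto simp: free_verts_def)

lemma finite_free_verts: "finite V \<Longrightarrow> finite (free_verts V \<Lambda> \<tau>)"
  using free_verts_subset by (rule finite_subset)

lemma Z_pos: "finite U \<Longrightarrow> 0 < Z U"
  using card_edge[of "{}"] lam_pos by (intro hardcore_Z_pos) auto

lemma empty_indep: "{} \<in> indep U"
  using card_edge[of "{}"] by (auto simp: indep_sets_of_def)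

lemma singleton_indep: "v \<in> U \<Longrightarrow> {v} \<in> indep U"
  using card_edge by (fastforce simp: indep_sets_of_def subset_singleton_iff)

lemma Un_occupied_indep_iff:
  assumes \<Lambda>: "\<Lambda> \<subseteq> V" and occ: "occupied \<Lambda> \<tau> \<in> indep V" and T: "T \<inter> \<Lambda> = {}"
  shows "T \<union> occupied \<Lambda> \<tau> \<in> indep V \<longleftrightarrow> T \<in> indep (free_verts V \<Lambda> \<tau>)"
proof
  assume indep: "T \<union> occupied \<Lambda> \<tau> \<in> indep V"
  have "v \<notin> nbrs u" if "v \<in> T" "u \<in> occupied \<Lambda> \<tau>" for u v
    using indep that by (auto simp: indep_sets_of_def nbrs_def)
  with indep T show "T \<in> indep (free_verts V \<Lambda> \<tau>)"
    by (fastforce simp: indep_sets_of_def free_verts_def)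
next
  assume indep: "T \<in> indep (free_verts V \<Lambda> \<tau>)"
  have "\<not> e \<subseteq> T \<union> occupied \<Lambda> \<tau>" if e: "e \<in> E" for e
  proof
    assume sub: "e \<subseteq> T \<union> occupied \<Lambda> \<tau>"
    obtain a b where ab: "e = {a, b}" using edgeE[OF e] .
    have "\<not> e \<subseteq> T" "\<not> e \<subseteq> occupied \<Lambda> \<tau>"
      using indep occ e by (auto simp: indep_sets_of_def)
    then obtain u v where uv: "e = {v, u}" "v \<in> T" "u \<in> occupied \<Lambda> \<tau>"
      using sub ab by (auto simp: insert_commute)
    then have "v \<in> nbrs u" using e by (simp add: nbrs_def)
    with uv indep show False by (auto simp: indep_sets_of_def free_verts_def)
  qed
  with indep occ show "T \<union> occupied \<Lambda> \<tau> \<in> indep V"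
    by (auto simp: indep_sets_of_def free_verts_def)
qed

lemma prob_gibbs:
  assumes "finite V"
  shows "measure_pmf.prob (gibbs V) A = (\<Sum>S | S \<in> indep V \<and> (\<lambda>v. v \<in> S) \<in> A. lam ^ card S) / Z V"
proof -
  let ?p = "hardcore_set_pmf V E lam" and ?B = "{S. S \<in> indep V \<and> (\<lambda>v. v \<in> S) \<in> A}"
  have pmf: "pmf ?p S = (if S \<in> indep V then lam ^ card S / Z V else 0)" for S
    using assms lam_pos card_edge[of "{}"] by (intro pmf_hardcore_set_pmf) auto
  have "measure_pmf.prob (gibbs V) A = measure_pmf.prob ?p ((\<lambda>S v. v \<in> S) -` A)"
    by (simp add: hardcore_def)
  also have "\<dots> = measure_pmf.prob ?p ?B"
    by (intro measure_prob_cong_0) (auto simp: pmf)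
  also have "\<dots> = (\<Sum>S\<in>?B. pmf ?p S)"
    using finite_indep_sets_of[OF assms, of E] by (intro measure_measure_pmf_finite) auto
  finally show ?thesis by (simp add: pmf sum_divide_distrib)
qed

lemma sum_indep_agrees:
  fixes f :: "'v set \<Rightarrow> 'a::comm_monoid_add"
  assumes \<Lambda>: "\<Lambda> \<subseteq> V" and occ: "occupied \<Lambda> \<tau> \<in> indep V"
  defines "U \<equiv> free_verts V \<Lambda> \<tau>"
  shows "(\<Sum>S | S \<in> indep V \<and> (\<lambda>v. v \<in> S) \<in> agrees \<Lambda> \<tau> \<inter> A. f S) =
    (\<Sum>T | T \<in> indep U \<and> (\<lambda>v. v \<in> T) \<in> {\<sigma>. override_on \<sigma> \<tau> \<Lambda> \<in> A}. f (T \<union> occupied \<Lambda> \<tau>))"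
proof (rule sum.reindex_bij_witness[of _ "\<lambda>T. T \<union> occupied \<Lambda> \<tau>" "\<lambda>S. S - \<Lambda>"])
  let ?L = "occupied \<Lambda> \<tau>"
  have override: "override_on (\<lambda>v. v \<in> T) \<tau> \<Lambda> = (\<lambda>v. v \<in> T \<union> ?L)" if "T \<inter> \<Lambda> = {}" for T
    using that by (auto simp: override_on_def occupied_def fun_eq_iff)
  {
    fix S assume S: "S \<in> {S. S \<in> indep V \<and> (\<lambda>v. v \<in> S) \<in> agrees \<Lambda> \<tau> \<inter> A}"
    then show split: "S - \<Lambda> \<union> ?L = S" by (auto simp: mem_agrees_iff_Int_eq_occupied)
    have "S - \<Lambda> \<in> indep U"
      unfolding U_def using Un_occupied_indep_iff[OF \<Lambda> occ, of "S - \<Lambda>"] S split by auto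
    moreover have "override_on (\<lambda>v. v \<in> S - \<Lambda>) \<tau> \<Lambda> = (\<lambda>v. v \<in> S)"
      using override[of "S - \<Lambda>"] unfolding split by blast
    ultimately show "S - \<Lambda> \<in> {T. T \<in> indep U \<and> (\<lambda>v. v \<in> T) \<in> {\<sigma>. override_on \<sigma> \<tau> \<Lambda> \<in> A}}"
      using S unfolding mem_Collect_eq by simp
    show "f (S - \<Lambda> \<union> ?L) = f S" by (simp only: split)
  next
    fix T assume T: "T \<in> {T. T \<in> indep U \<and> (\<lambda>v. v \<in> T) \<in> {\<sigma>. override_on \<sigma> \<tau> \<Lambda> \<in> A}}"
    then have disj: "T \<inter> \<Lambda> = {}" by (auto simp: U_def indep_sets_of_def free_verts_def)
    then show "T \<union> ?L - \<Lambda> = T" by (auto simp: occupied_def)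
    show "T \<union> ?L \<in> {S. S \<in> indep V \<and> (\<lambda>v. v \<in> S) \<in> agrees \<Lambda> \<tau> \<inter> A}"
      using T disj override[OF disj] Un_occupied_indep_iff[OF \<Lambda> occ, of T]
      by (auto simp: U_def mem_agrees_iff_Int_eq_occupied occupied_def)
  }
qed

lemma card_Un_occupied:
  assumes V: "finite V" "\<Lambda> \<subseteq> V" and T: "T \<in> indep (free_verts V \<Lambda> \<tau>)"
  shows "card (T \<union> occupied \<Lambda> \<tau>) = card T + card (occupied \<Lambda> \<tau>)"
proof (rule card_Un_disjoint)
  show "finite T" using V T by (auto simp: indep_sets_of_def free_verts_def intro: finite_subset)
  show "finite (occupied \<Lambda> \<tau>)" using V by (auto simp: occupied_def intro: finite_subset)
  show "T \<inter> occupied \<Lambda> \<tau> = {}" using T by (auto simp: indep_sets_of_def free_verts_def occupied_def)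
qed

lemma prob_gibbs_agrees:
  assumes V: "finite V" and \<Lambda>: "\<Lambda> \<subseteq> V" and occ: "occupied \<Lambda> \<tau> \<in> indep V"
  defines "U \<equiv> free_verts V \<Lambda> \<tau>"
  shows "measure_pmf.prob (gibbs V) (agrees \<Lambda> \<tau>) = lam ^ card (occupied \<Lambda> \<tau>) * Z U / Z V"
    and "measure_pmf.prob (gibbs V) (agrees \<Lambda> \<tau> \<inter> A) =
      measure_pmf.prob (gibbs V) (agrees \<Lambda> \<tau>) * measure_pmf.prob (gibbs U) {\<sigma>. override_on \<sigma> \<tau> \<Lambda> \<in> A}"
proof -
  let ?w = "lam ^ card (occupied \<Lambda> \<tau>)"
  have U: "finite U" unfolding U_def using V by (rule finite_free_verts)
  have joint: "measure_pmf.prob (gibbs V) (agrees \<Lambda> \<tau> \<inter> B) =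
      ?w * Z U / Z V * measure_pmf.prob (gibbs U) {\<sigma>. override_on \<sigma> \<tau> \<Lambda> \<in> B}" for B
  proof -
    let ?J = "{T. T \<in> indep U \<and> (\<lambda>v. v \<in> T) \<in> {\<sigma>. override_on \<sigma> \<tau> \<Lambda> \<in> B}}"
    have "(\<Sum>S | S \<in> indep V \<and> (\<lambda>v. v \<in> S) \<in> agrees \<Lambda> \<tau> \<inter> B. lam ^ card S) =
        (\<Sum>T\<in>?J. lam ^ card (T \<union> occupied \<Lambda> \<tau>))"
      unfolding U_def using \<Lambda> occ by (rule sum_indep_agrees)
    also have "\<dots> = (\<Sum>T\<in>?J. ?w * lam ^ card T)"
      using card_Un_occupied[OF V \<Lambda>] by (intro sum.cong) (auto simp: U_def power_add)
    finally show ?thesis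
      using Z_pos[OF U] by (simp add: prob_gibbs V U flip: sum_distrib_left)
  qed
  show agrees: "measure_pmf.prob (gibbs V) (agrees \<Lambda> \<tau>) = ?w * Z U / Z V"
    using joint[of UNIV] by simp
  show "measure_pmf.prob (gibbs V) (agrees \<Lambda> \<tau> \<inter> A) =
      measure_pmf.prob (gibbs V) (agrees \<Lambda> \<tau>) * measure_pmf.prob (gibbs U) {\<sigma>. override_on \<sigma> \<tau> \<Lambda> \<in> A}"
    unfolding agrees by (rule joint)
qed

lemma occupied_indep_if_pinning:
  assumes V: "finite V" and pin: "pinning V (gibbs V) \<Lambda> \<tau>"
  shows "occupied \<Lambda> \<tau> \<in> indep V"
proof -
  have "measure_pmf.prob (gibbs V) (agrees \<Lambda> \<tau>) \<noteq> 0"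
    using pin by (simp add: pinning_def)
  then have "{S. S \<in> indep V \<and> (\<lambda>v. v \<in> S) \<in> agrees \<Lambda> \<tau>} \<noteq> {}"
    unfolding prob_gibbs[OF V] by (metis div_0 sum.empty)
  then obtain S where "S \<in> indep V" "occupied \<Lambda> \<tau> \<subseteq> S"
    by (auto simp: mem_agrees_iff_Int_eq_occupied)
  then show ?thesis unfolding indep_sets_of_def using subset_trans by blast
qed

lemma pinned_gibbs:
  assumes V: "finite V" and pin: "pinning V (gibbs V) \<Lambda> \<tau>"
  shows "pinned (gibbs V) \<Lambda> \<tau> = map_pmf (\<lambda>\<sigma>. override_on \<sigma> \<tau> \<Lambda>) (gibbs (free_verts V \<Lambda> \<tau>))"
proof (rule pmf_eqI)
  fix \<sigma>
  have \<Lambda>: "\<Lambda> \<subseteq> V" and pos: "measure_pmf.prob (gibbs V) (agrees \<Lambda> \<tau>) > 0"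
    using pin by (auto simp: pinning_def)
  note occ = occupied_indep_if_pinning[OF V pin]
  have "pmf (pinned (gibbs V) \<Lambda> \<tau>) \<sigma> =
      measure_pmf.prob (gibbs V) (agrees \<Lambda> \<tau> \<inter> {\<sigma>}) / measure_pmf.prob (gibbs V) (agrees \<Lambda> \<tau>)"
    using prob_cond_pmf[OF pos] by (simp add: pinned_def flip: measure_pmf_single)
  also have "\<dots> = measure_pmf.prob (gibbs (free_verts V \<Lambda> \<tau>)) {\<rho>. override_on \<rho> \<tau> \<Lambda> \<in> {\<sigma>}}"
    using pos by (simp add: prob_gibbs_agrees(2)[OF V \<Lambda> occ])
  also have "\<dots> = pmf (map_pmf (\<lambda>\<sigma>. override_on \<sigma> \<tau> \<Lambda>) (gibbs (free_verts V \<Lambda> \<tau>))) \<sigma>"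
    by (simp add: vimage_def flip: measure_pmf_single)
  finally show "pmf (pinned (gibbs V) \<Lambda> \<tau>) \<sigma> =
      pmf (map_pmf (\<lambda>\<sigma>. override_on \<sigma> \<tau> \<Lambda>) (gibbs (free_verts V \<Lambda> \<tau>))) \<sigma>" .
qed

definition marg :: "'v set \<Rightarrow> 'v \<Rightarrow> real" where
  "marg U v = measure_pmf.prob (gibbs U) {\<sigma>. \<sigma> v}"

lemma marg_outside:
  assumes "finite U" "v \<notin> U"
  shows "marg U v = 0"
  using assms by (auto simp: marg_def prob_gibbs indep_sets_of_def intro!: sum.neutral)

lemma marg_eq:
  assumes U: "finite U" "v \<in> U"
  shows "marg U v = lam * Z (U - {v} - nbrs v) / Z U"
proof -
  have "agrees {v} (\<lambda>_. True) = {\<sigma>. \<sigma> v}" by (simp add: agrees_def)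
  then show ?thesis
    using prob_gibbs_agrees(1)[of U "{v}" "\<lambda>_. True"] U singleton_indep[OF U(2)]
    by (simp add: marg_def occupied_def free_verts_def)
qed

lemma prob_vacant_eq:
  assumes U: "finite U" "v \<in> U"
  shows "measure_pmf.prob (gibbs U) {\<sigma>. \<not> \<sigma> v} = Z (U - {v}) / Z U"
proof -
  have "agrees {v} (\<lambda>_. False) = {\<sigma>. \<not> \<sigma> v}" by (simp add: agrees_def)
  then show ?thesis
    using prob_gibbs_agrees(1)[of U "{v}" "\<lambda>_. False"] U empty_indep
    by (simp add: occupied_def free_verts_def)
qed

lemma prob_vacant_eq_one_minus_marg: "measure_pmf.prob (gibbs U) {\<sigma>. \<not> \<sigma> v} = 1 - marg U v"
  using measure_pmf.prob_compl[of "{\<sigma>. \<sigma> v}" "gibbs U"]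
  by (simp add: marg_def Compl_eq_Diff_UNIV[symmetric] Collect_neg_eq)

lemma Z_delete:
  assumes "finite U" "v \<in> U"
  shows "Z (U - {v}) = Z U * (1 - marg U v)"
  using prob_vacant_eq[OF assms] Z_pos[OF assms(1)] by (simp add: prob_vacant_eq_one_minus_marg field_simps)

lemma marg_nonneg: "0 \<le> marg U v"
  by (simp add: marg_def)

lemma marg_pos: "finite U \<Longrightarrow> v \<in> U \<Longrightarrow> 0 < marg U v"
  using Z_pos[of U] Z_pos[of "U - {v} - nbrs v"] lam_pos by (simp add: marg_eq)

lemma marg_less_1:
  assumes "finite U"
  shows "marg U v < 1"
proof (cases "v \<in> U")
  case True
  have "0 < Z (U - {v}) / Z U" using assms Z_pos by simp
  then have "0 < 1 - marg U v"
    unfolding prob_vacant_eq[OF assms True, symmetric] prob_vacant_eq_one_minus_marg .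
  then show ?thesis by simp
qed (simp add: marg_outside assms)

lemma cond_prob_occupied:
  assumes U: "finite U" "v \<in> U" and "j \<noteq> v"
  shows "\<P>(\<sigma> in measure_pmf (gibbs U). \<sigma> j \<bar> \<sigma> v) = marg (U - {v} - nbrs v) j"
proof -
  have "agrees {v} (\<lambda>_. True) = {\<sigma>. \<sigma> v}" "agrees {v} (\<lambda>_. True) \<inter> {\<sigma>. \<sigma> j} = {\<sigma>. \<sigma> j \<and> \<sigma> v}"
    by (auto simp: agrees_def)
  then have "measure_pmf.prob (gibbs U) {\<sigma>. \<sigma> j \<and> \<sigma> v} = marg U v * marg (U - {v} - nbrs v) j"
    using prob_gibbs_agrees(2)[of U "{v}" "\<lambda>_. True" "{\<sigma>. \<sigma> j}"] singleton_indep[OF U(2)] U \<open>j \<noteq> v\<close>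
    by (simp add: marg_def occupied_def free_verts_def)
  then show ?thesis
    using marg_pos[OF U] by (simp add: cond_prob_def marg_def)
qed

lemma cond_prob_vacant:
  assumes U: "finite U" "v \<in> U"
  shows "\<P>(\<sigma> in measure_pmf (gibbs U). \<sigma> j \<bar> \<not> \<sigma> v) = marg (U - {v}) j"
proof (cases "j = v")
  case True
  then show ?thesis using marg_outside[of "U - {v}" v] U by (simp add: cond_prob_def)
next
  case False
  let ?vacant = "measure_pmf.prob (gibbs U) {\<sigma>. \<not> \<sigma> v}"
  have "agrees {v} (\<lambda>_. False) = {\<sigma>. \<not> \<sigma> v}" "agrees {v} (\<lambda>_. False) \<inter> {\<sigma>. \<sigma> j} = {\<sigma>. \<sigma> j \<and> \<not> \<sigma> v}"
    by (auto simp: agrees_def)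
  then have "measure_pmf.prob (gibbs U) {\<sigma>. \<sigma> j \<and> \<not> \<sigma> v} = ?vacant * marg (U - {v}) j"
    using prob_gibbs_agrees(2)[of U "{v}" "\<lambda>_. False" "{\<sigma>. \<sigma> j}"] empty_indep U False
    by (simp add: marg_def occupied_def free_verts_def)
  moreover have "0 < ?vacant"
    using marg_less_1[OF U(1), of v] by (simp add: prob_vacant_eq_one_minus_marg)
  ultimately show ?thesis by (simp add: cond_prob_def)
qed

lemma influence_self:
  assumes "finite U" "v \<in> U"
  shows "influence (gibbs U) v v = 1"
  using marg_pos[OF assms] by (simp add: influence_def cond_prob_def marg_def)

lemma influence_gibbs:
  assumes "finite U" "v \<in> U" "j \<noteq> v"
  shows "influence (gibbs U) v j = marg (U - {v} - nbrs v) j - marg (U - {v}) j"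
  using assms by (simp add: influence_def cond_prob_occupied cond_prob_vacant)

lemma influence_outside:
  assumes "finite U" "v \<in> U" "j \<notin> U"
  shows "influence (gibbs U) v j = 0"
  using assms influence_gibbs[of U v j] by (auto simp: marg_outside)

definition total_influence :: "'v set \<Rightarrow> 'v \<Rightarrow> real" where
  "total_influence U v = (\<Sum>j\<in>U. \<bar>influence (gibbs U) v j\<bar>)"

lemma active_pinned:
  assumes V: "finite V" and pin: "pinning V (gibbs V) \<Lambda> \<tau>"
  shows "active V (pinned (gibbs V) \<Lambda> \<tau>) = free_verts V \<Lambda> \<tau>"
proof -
  let ?U = "free_verts V \<Lambda> \<tau>"
  note fin = finite_free_verts[OF V, of \<Lambda> \<tau>]
  have "\<P>(\<sigma> in measure_pmf (pinned (gibbs V) \<Lambda> \<tau>). \<not> \<sigma> i) > 0 \<and>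
      \<P>(\<sigma> in measure_pmf (pinned (gibbs V) \<Lambda> \<tau>). \<sigma> i) > 0 \<longleftrightarrow> i \<in> ?U" for i
  proof (cases "i \<in> \<Lambda>")
    case True
    then show ?thesis by (auto simp: pinned_gibbs[OF V pin] vimage_def free_verts_def)
  next
    case False
    have "1 - marg ?U i > 0 \<and> marg ?U i > 0 \<longleftrightarrow> i \<in> ?U"
      using marg_less_1[OF fin, of i] marg_pos[OF fin, of i] marg_outside[OF fin, of i]
      by (cases "i \<in> ?U") simp_all
    with False show ?thesis
      by (simp add: pinned_gibbs[OF V pin] vimage_def marg_def prob_vacant_eq_one_minus_marg)
  qed
  then show ?thesis using free_verts_subset[of V \<Lambda> \<tau>] by (auto simp: active_def)
qed

lemma max_influence_pinned:
  assumes V: "finite V" and pin: "pinning V (gibbs V) \<Lambda> \<tau>"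
  defines "U \<equiv> free_verts V \<Lambda> \<tau>"
  shows "max_influence V (pinned (gibbs V) \<Lambda> \<tau>) = (if U = {} then 0 else MAX i\<in>U. total_influence U i)"
proof -
  have "influence (pinned (gibbs V) \<Lambda> \<tau>) i j = influence (gibbs U) i j" if "i \<in> U" "j \<in> U" for i j
    unfolding pinned_gibbs[OF V pin] U_def using that
    by (intro influence_map_pmf) (auto simp: U_def free_verts_def)
  then have "(\<Sum>j\<in>U. \<bar>influence (pinned (gibbs V) \<Lambda> \<tau>) i j\<bar>) = total_influence U i" if "i \<in> U" for i
    unfolding total_influence_def using that by (intro sum.cong) auto
  then show ?thesis
    unfolding max_influence_def active_pinned[OF V pin] U_def[symmetric]
    by (simp cong: image_cong_simp)
qed

lemma total_influence_le_linf_SI_constant: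
  assumes V: "finite V" "v \<in> V"
  shows "total_influence V v \<le> linf_SI_constant V (gibbs V)"
proof -
  have pin: "pinning V (gibbs V) {} \<tau>" and free: "free_verts V {} \<tau> = V" for \<tau>
    by (simp_all add: pinning_def agrees_def free_verts_def occupied_def)
  have "total_influence V v \<le> (MAX i\<in>V. total_influence V i)"
    using V by (intro Max_ge) auto
  also have "\<dots> = max_influence V (pinned (gibbs V) {} (\<lambda>_. False))"
    using V by (auto simp: max_influence_pinned[OF V(1) pin] free)
  also have "\<dots> \<le> linf_SI_constant V (gibbs V)"
    using linf_spectrally_independent_iff[OF V(1), of "gibbs V" "linf_SI_constant V (gibbs V)"] pin
    by (auto simp: linf_spectrally_independent_def)
  finally show ?thesis .
qed

end

section \<open>Deleting the neighbourhood of a vertex\<close>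

context hardcore_graph
begin

lemma marg_delete:
  assumes "finite U" "v \<in> U"
  shows "marg U j - marg (U - {v}) j = marg U v * influence (gibbs U) v j"
  using prob_minus_cond_prob_eq_influence[of "gibbs U" v j] marg_less_1[OF assms(1), of v]
  by (simp add: cond_prob_vacant[OF assms] prob_vacant_eq_one_minus_marg flip: marg_def)

lemma delete_by_rank:
  fixes r :: "'v \<Rightarrow> nat"
  assumes U: "finite U" and "N \<subseteq> U" "inj_on r N"
  defines "left \<equiv> \<lambda>N u. U - {w \<in> N. r w < r u}"
  shows "Z (U - N) = Z U * (\<Prod>u\<in>N. 1 - marg (left N u) u) \<and>
    (\<forall>j. marg U j - marg (U - N) j = (\<Sum>u\<in>N. marg (left N u) u * influence (gibbs (left N u)) u j))"
proof -
  have "finite N" using U \<open>N \<subseteq> U\<close> by (rule rev_finite_subset)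
  then show ?thesis using \<open>N \<subseteq> U\<close> \<open>inj_on r N\<close>
  proof (induction N rule: finite_ranking_induct[where f = r])
    case (insert v N)
    show ?case
    proof (cases "v \<in> N")
      case True
      show ?thesis
        using insert.IH insert.prems unfolding insert_absorb[OF True] by blast
    next
      case False
      have rank: "r u < r v" if "u \<in> N" for u
      proof -
        have "r u \<noteq> r v" using inj_onD[OF insert.prems(2), of u v] that False by blast
        with insert.hyps(2)[OF that] show ?thesis by simp
      qed
      have left_v: "left (insert v N) v = U - N"
        using rank by (auto simp: left_def)
      have left_u: "left (insert v N) u = left N u" if "u \<in> N" for u
        using rank[OF that] by (auto simp: left_def)
      have v: "finite (U - N)" "v \<in> U - N" and eq: "U - insert v N = U - N - {v}"
        using U insert.prems(1) False by auto
      have "N \<subseteq> U" "inj_on r N" using insert.prems by auto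
      note IH = insert.IH[OF this]
      show ?thesis
      proof (intro conjI allI)
        show "Z (U - insert v N) = Z U * (\<Prod>u\<in>insert v N. 1 - marg (left (insert v N) u) u)"
          unfolding eq Z_delete[OF v] conjunct1[OF IH] using insert.hyps(1) False by (simp add: left_v left_u)
        fix j
        show "marg U j - marg (U - insert v N) j =
            (\<Sum>u\<in>insert v N. marg (left (insert v N) u) u * influence (gibbs (left (insert v N) u)) u j)"
          unfolding eq using insert.hyps(1) False marg_delete[OF v, of j] spec[OF conjunct2[OF IH], of j]
          by (simp add: left_v left_u)
      qed
    qed
  qed simp
qed

text \<open>The neighbours of \<open>v\<close> are deleted in an arbitrary fixed order; \<open>pruned U v u\<close> is what is left when
  it is the turn of \<open>u\<close>.\<close>

definition pruned :: "'v set \<Rightarrow> 'v \<Rightarrow> 'v \<Rightarrow> 'v set" where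
  "pruned U v u =
    U - {v} - {w \<in> U \<inter> nbrs v. to_nat_on (U \<inter> nbrs v) w < to_nat_on (U \<inter> nbrs v) u}"

lemma pruned_subset: "pruned U v u \<subseteq> U - {v}"
  by (auto simp: pruned_def)

lemma Diff_nbrs_subset_pruned: "U - {v} - nbrs v \<subseteq> pruned U v u"
  by (auto simp: pruned_def)

lemma mem_pruned: "u \<in> U \<inter> nbrs v \<Longrightarrow> u \<in> pruned U v u"
  using nbrs_irrefl by (auto simp: pruned_def)

lemma finite_pruned: "finite U \<Longrightarrow> finite (pruned U v u)"
  using pruned_subset by (rule finite_subset) simp

lemma delete_nbrs:
  assumes U: "finite U"
  shows "Z (U - {v} - nbrs v) = Z (U - {v}) * (\<Prod>u\<in>U \<inter> nbrs v. 1 - marg (pruned U v u) u)"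
    and "marg (U - {v}) j - marg (U - {v} - nbrs v) j =
      (\<Sum>u\<in>U \<inter> nbrs v. marg (pruned U v u) u * influence (gibbs (pruned U v u)) u j)"
proof -
  have inj: "inj_on (to_nat_on (U \<inter> nbrs v)) (U \<inter> nbrs v)"
    using U by (intro inj_on_to_nat_on countable_finite) auto
  have sub: "U \<inter> nbrs v \<subseteq> U - {v}" and eq: "U - {v} - U \<inter> nbrs v = U - {v} - nbrs v"
    using nbrs_irrefl by auto
  note delete = delete_by_rank[OF finite_Diff[OF U] sub inj, unfolded eq, folded pruned_def]
  show "Z (U - {v} - nbrs v) = Z (U - {v}) * (\<Prod>u\<in>U \<inter> nbrs v. 1 - marg (pruned U v u) u)"
    by (rule conjunct1[OF delete])
  show "marg (U - {v}) j - marg (U - {v} - nbrs v) j =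
      (\<Sum>u\<in>U \<inter> nbrs v. marg (pruned U v u) u * influence (gibbs (pruned U v u)) u j)"
    by (rule spec[OF conjunct2[OF delete]])
qed

lemma marg_recursion:
  assumes U: "finite U" "v \<in> U"
  defines "\<rho> \<equiv> lam * (\<Prod>u\<in>U \<inter> nbrs v. 1 - marg (pruned U v u) u)"
  shows "marg U v = \<rho> / (1 + \<rho>)"
proof -
  have pos: "0 < Z U" "0 < Z (U - {v})" using U Z_pos by auto
  have occ: "marg U v * Z U = Z (U - {v}) * \<rho>"
    using pos by (simp add: marg_eq[OF U] delete_nbrs(1)[OF U(1)] \<rho>_def)
  have "Z U = Z (U - {v}) + marg U v * Z U"
    unfolding Z_delete[OF U] by (simp add: algebra_simps)
  also have "\<dots> = Z (U - {v}) * (1 + \<rho>)"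
    unfolding occ by (simp add: distrib_left)
  finally have "marg U v = (Z (U - {v}) * \<rho>) / (Z (U - {v}) * (1 + \<rho>))"
    using occ pos by (metis less_irrefl nonzero_eq_divide_eq)
  then show ?thesis using pos by simp
qed

lemma influence_recursion:
  assumes "finite U" "v \<in> U" "j \<noteq> v"
  shows "influence (gibbs U) v j =
    - (\<Sum>u\<in>U \<inter> nbrs v. marg (pruned U v u) u * influence (gibbs (pruned U v u)) u j)"
  using influence_gibbs[OF assms] delete_nbrs(2)[OF assms(1), of v j] by simp

definition weighted_influence :: "('v \<Rightarrow> real) \<Rightarrow> 'v set \<Rightarrow> 'v \<Rightarrow> real" where
  "weighted_influence s U v = (\<Sum>j\<in>U. s j * influence (gibbs U) v j)"

lemma weighted_influence_recursion:
  assumes U: "finite U" "v \<in> U"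
  shows "weighted_influence s U v =
    s v - (\<Sum>u\<in>U \<inter> nbrs v. marg (pruned U v u) u * weighted_influence s (pruned U v u) u)"
proof -
  let ?N = "U \<inter> nbrs v" and ?W = "pruned U v"
  have restrict: "(\<Sum>j\<in>U - {v}. s j * influence (gibbs (?W u)) u j) = weighted_influence s (?W u) u"
    if "u \<in> ?N" for u
    unfolding weighted_influence_def
    using U(1) pruned_subset influence_outside[OF finite_pruned[OF U(1)] mem_pruned[OF that]]
    by (intro sum.mono_neutral_right) auto
  have "(\<Sum>j\<in>U - {v}. s j * influence (gibbs U) v j) =
      (\<Sum>j\<in>U - {v}. - (\<Sum>u\<in>?N. marg (?W u) u * (s j * influence (gibbs (?W u)) u j)))"
    by (intro sum.cong) (auto simp: influence_recursion[OF U] sum_distrib_left mult_ac)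
  also have "\<dots> = - (\<Sum>u\<in>?N. marg (?W u) u * (\<Sum>j\<in>U - {v}. s j * influence (gibbs (?W u)) u j))"
    by (simp only: sum_negf, subst sum.swap) (simp add: sum_distrib_left)
  finally show ?thesis
    using U by (simp add: weighted_influence_def[of s U] sum.remove[of U v] influence_self restrict)
qed

lemma abs_weighted_influence_le_total:
  assumes "\<And>j. \<bar>s j\<bar> \<le> 1"
  shows "\<bar>weighted_influence s U v\<bar> \<le> total_influence U v"
proof -
  have "\<bar>weighted_influence s U v\<bar> \<le> (\<Sum>j\<in>U. \<bar>s j\<bar> * \<bar>influence (gibbs U) v j\<bar>)"
    using sum_abs by (simp add: weighted_influence_def flip: abs_mult)
  also have "\<dots> \<le> (\<Sum>j\<in>U. 1 * \<bar>influence (gibbs U) v j\<bar>)"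
    using assms by (intro sum_mono mult_right_mono) auto
  finally show ?thesis by (simp add: total_influence_def)
qed

lemma total_influence_le_recursion:
  assumes U: "finite U" "v \<in> U"
  shows "total_influence U v \<le>
    1 + (\<Sum>u\<in>U \<inter> nbrs v. marg (pruned U v u) u * total_influence (pruned U v u) u)"
proof -
  define s where "s j = sgn (influence (gibbs U) v j)" for j
  have s: "\<bar>s j\<bar> \<le> 1" for j by (simp add: s_def abs_sgn_eq)
  have "total_influence U v = weighted_influence s U v"
    by (simp add: total_influence_def weighted_influence_def s_def abs_sgn mult.commute)
  also have "\<dots> = s v + (\<Sum>u\<in>U \<inter> nbrs v. marg (pruned U v u) u * - weighted_influence s (pruned U v u) u)"
    by (simp add: weighted_influence_recursion[OF U] sum_negf)
  also have "\<dots> \<le> 1 + (\<Sum>u\<in>U \<inter> nbrs v. marg (pruned U v u) u * total_influence (pruned U v u) u)"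
    using s abs_le_D1[OF s] abs_le_D2[OF abs_weighted_influence_le_total[OF s]]
    by (intro add_mono sum_mono mult_left_mono marg_nonneg)
  finally show ?thesis .
qed

end

section \<open>Upper bound for graphs of bounded degree\<close>

context hardcore_graph
begin

definition degree :: "'v set \<Rightarrow> 'v \<Rightarrow> nat" where
  "degree U v = card (U \<inter> nbrs v)"

lemma degree_mono: "finite U \<Longrightarrow> W \<subseteq> U \<Longrightarrow> degree W v \<le> degree U v"
  unfolding degree_def by (intro card_mono) auto

lemma degree_pruned_less:
  assumes "finite U" "v \<in> U" "u \<in> nbrs v"
  shows "degree (pruned U v u) u < degree U u"
  unfolding degree_def using assms pruned_subset nbrs_sym
  by (intro psubset_card_mono) blast+

lemma degree_pruned_le:
  assumes U: "finite U" "v \<in> U" and deg: "\<And>u. u \<in> U \<Longrightarrow> degree U u \<le> Suc k"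
    and u: "u \<in> U \<inter> nbrs v"
  shows "degree (pruned U v u) u \<le> k"
    and "w \<in> pruned U v u \<Longrightarrow> degree (pruned U v u) w \<le> Suc k"
proof -
  show "degree (pruned U v u) u \<le> k"
    using degree_pruned_less[OF U, of u] deg[of u] u by simp
  assume "w \<in> pruned U v u"
  then show "degree (pruned U v u) w \<le> Suc k"
    using degree_mono[OF U(1), of "pruned U v u" w] pruned_subset[of U v u] deg[of w] by force
qed

lemma total_influence_le_of_children:
  assumes U: "finite U" "v \<in> U" and k: "degree U v \<le> k" and b: "0 \<le> b"
    and children: "\<And>u. u \<in> U \<inter> nbrs v \<Longrightarrow> marg (pruned U v u) u * total_influence (pruned U v u) u \<le> b"
  shows "total_influence U v \<le> 1 + real k * b"
proof -
  have "(\<Sum>u\<in>U \<inter> nbrs v. marg (pruned U v u) u * total_influence (pruned U v u) u) \<le> real (degree U v) * b"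
    unfolding degree_def using children by (rule sum_bounded_above)
  also have "\<dots> \<le> real k * b" using k b by (intro mult_right_mono) auto
  finally show ?thesis using total_influence_le_recursion[OF U] by linarith
qed

end

locale stable_hardcore_graph = hardcore_graph E lam + stable_fixed_point d lam xhat
  for E :: "'v set set" and lam xhat :: real and d :: nat
begin

text \<open>The two bounds are proved simultaneously: at a neighbour \<open>u\<close> with marginal \<open>x\<close> they say that
  \<open>x * total_influence\<close> is at most \<open>K * min x xhat\<close> with \<open>K = 1 / (1 - d * xhat)\<close>.\<close>

lemma total_influence_bounds:
  assumes "finite U" "v \<in> U" "degree U v \<le> d" "\<And>u. u \<in> U \<Longrightarrow> degree U u \<le> Suc d"
  shows "total_influence U v \<le> 1 / (1 - real d * xhat) \<and>
    marg U v * total_influence U v \<le> xhat / (1 - real d * xhat)"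
  using assms
proof (induction "card U" arbitrary: U v rule: less_induct)
  case less
  let ?N = "U \<inter> nbrs v" and ?W = "pruned U v" and ?gap = "1 - real d * xhat"
  note fin = finite_pruned[OF less.prems(1)]
  have IH: "total_influence (?W u) u \<le> 1 / ?gap" "marg (?W u) u * total_influence (?W u) u \<le> xhat / ?gap"
    if u: "u \<in> ?N" for u
  proof -
    have "?W u \<subset> U" using pruned_subset less.prems(2) by blast
    then have "card (?W u) < card U" using less.prems(1) by (rule psubset_card_mono[rotated])
    then show "total_influence (?W u) u \<le> 1 / ?gap"
        "marg (?W u) u * total_influence (?W u) u \<le> xhat / ?gap"
      using less.hyps[OF _ fin mem_pruned[OF u]] degree_pruned_le[OF less.prems(1,2,4) u] by auto
  qed
  have "total_influence U v \<le> 1 + real d * (xhat / ?gap)"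
    using less.prems IH(2) xhat_nonneg stable by (intro total_influence_le_of_children) auto
  also have "\<dots> = 1 / ?gap" using stable by (simp add: field_simps)
  finally have total: "total_influence U v \<le> 1 / ?gap" .
  have "(\<Sum>u\<in>?N. marg (?W u) u * total_influence (?W u) u) \<le> (\<Sum>u\<in>?N. marg (?W u) u * (1 / ?gap))"
    using IH(1) marg_nonneg by (intro sum_mono mult_left_mono)
  also have "\<dots> = (\<Sum>u\<in>?N. marg (?W u) u) / ?gap"
    by (simp add: sum_divide_distrib)
  finally have "total_influence U v \<le> 1 + (\<Sum>u\<in>?N. marg (?W u) u) / ?gap"
    using total_influence_le_recursion[OF less.prems(1,2)] by linarith
  then have "marg U v * total_influence U v \<le> marg U v * (1 + (\<Sum>u\<in>?N. marg (?W u) u) / ?gap)"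
    using marg_nonneg by (rule mult_left_mono)
  also have "\<dots> \<le> xhat / ?gap"
    unfolding marg_recursion[OF less.prems(1,2)] using less.prems(1,3) marg_less_1[OF fin]
    by (intro hardcore_recursion_times_sum_le) (auto simp: degree_def less_imp_le)
  finally show ?case using total by blast
qed

lemma total_influence_le:
  assumes U: "finite U" "v \<in> U" and deg: "\<And>u. u \<in> U \<Longrightarrow> degree U u \<le> Suc d"
  shows "total_influence U v \<le> (1 + xhat) / (1 - real d * xhat)"
proof -
  have "marg (pruned U v u) u * total_influence (pruned U v u) u \<le> xhat / (1 - real d * xhat)"
    if u: "u \<in> U \<inter> nbrs v" for u
    using total_influence_bounds[OF finite_pruned[OF U(1)] mem_pruned[OF u]] degree_pruned_le[OF U deg u]
    by blast
  then have "total_influence U v \<le> 1 + real (Suc d) * (xhat / (1 - real d * xhat))"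
    using U deg xhat_nonneg stable by (intro total_influence_le_of_children) auto
  also have "\<dots> = (1 + xhat) / (1 - real d * xhat)"
    using stable by (simp add: field_simps)
  finally show ?thesis .
qed

lemma linf_SI_constant_le:
  assumes V: "finite V" and deg: "\<And>u. u \<in> V \<Longrightarrow> degree V u \<le> Suc d"
  shows "linf_SI_constant V (gibbs V) \<le> (1 + xhat) / (1 - real d * xhat)"
  unfolding linf_spectrally_independent_iff[OF V, symmetric] linf_spectrally_independent_def
proof (intro allI impI)
  fix \<Lambda> \<tau> assume pin: "pinning V (gibbs V) \<Lambda> \<tau>"
  let ?U = "free_verts V \<Lambda> \<tau>"
  note fin = finite_free_verts[OF V, of \<Lambda> \<tau>]
  have "degree ?U u \<le> Suc d" if "u \<in> ?U" for u
    using degree_mono[OF V free_verts_subset] deg that free_verts_subset by (meson le_trans subsetD)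
  then have "total_influence ?U i \<le> (1 + xhat) / (1 - real d * xhat)" if "i \<in> ?U" for i
    using total_influence_le[OF fin that] by blast
  then show "max_influence V (pinned (gibbs V) \<Lambda> \<tau>) \<le> (1 + xhat) / (1 - real d * xhat)"
    using xhat_nonneg stable fin by (auto simp: max_influence_pinned[OF V pin])
qed

end

section \<open>Lower bound at the root of the tree\<close>

definition branch_marg :: "nat \<Rightarrow> real \<Rightarrow> nat \<Rightarrow> real" where
  "branch_marg d lam n = (hardcore_F d lam ^^ Suc n) 0"

primrec branch_influence :: "nat \<Rightarrow> real \<Rightarrow> nat \<Rightarrow> real" where
  "branch_influence d lam 0 = 1"
| "branch_influence d lam (Suc n) = 1 + real d * branch_marg d lam n * branch_influence d lam n"

lemma (in stable_fixed_point) branch_influence_tendsto: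
  assumes "branch_marg d lam \<longlonglongrightarrow> xhat"
  shows "branch_influence d lam \<longlonglongrightarrow> 1 / (1 - real d * xhat)"
proof (rule affine_recursion_tendsto)
  show "(\<lambda>n. real d * branch_marg d lam n) \<longlonglongrightarrow> real d * xhat"
    using assms by (rule tendsto_mult_left)
qed (use xhat_nonneg stable in auto)

locale hardcore_tree =
  fixes d h :: nat and lam :: real
  assumes fugacity_pos: "0 < lam"
begin

abbreviation V :: "nat list set" where
  "V \<equiv> tree_verts (Suc d) h"

definition children :: "nat list \<Rightarrow> nat list set" where
  "children w = {w @ [c] | c. w @ [c] \<in> V}"

lemma childrenD:
  assumes "u \<in> children w"
  shows "u \<noteq> []" "length u = Suc (length w)"
  using assms by (auto simp: children_def)

lemma prefix_in_verts:
  assumes "w @ z \<in> V"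
  shows "w \<in> V"
proof -
  have "length w \<le> h" using assms by (simp add: tree_verts_def)
  moreover have "w ! k < (if k = 0 then Suc d else Suc d - 1)" if "k < length w" for k
  proof -
    have "(w @ z) ! k < (if k = 0 then Suc d else Suc d - 1)"
      using assms that unfolding tree_verts_def mem_Collect_eq by (metis length_append trans_less_add1)
    then show ?thesis using that by (simp only: nth_append if_True)
  qed
  ultimately show ?thesis unfolding tree_verts_def by blast
qed

lemma child_in_verts_iff:
  "w @ [c] \<in> V \<longleftrightarrow> w \<in> V \<and> length w < h \<and> c < (if w = [] then Suc d else d)"
proof
  assume child: "w @ [c] \<in> V"
  then have "c < (if w = [] then Suc d else d)"
    unfolding tree_verts_def by (auto simp: nth_append dest!: spec[of _ "length w"])
  with child prefix_in_verts[OF child] show "w \<in> V \<and> length w < h \<and> c < (if w = [] then Suc d else d)"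
    by (auto simp: tree_verts_def)
next
  assume "w \<in> V \<and> length w < h \<and> c < (if w = [] then Suc d else d)"
  then show "w @ [c] \<in> V"
    by (auto simp: tree_verts_def nth_append less_Suc_eq split: if_splits)
qed

lemma root_in_verts: "[] \<in> V"
  by (simp add: tree_verts_def)

lemma card_children:
  assumes "w \<in> V"
  shows "card (children w) = (if length w < h then if w = [] then Suc d else d else 0)"
proof (cases "length w < h")
  case True
  then have "children w = (\<lambda>c. w @ [c]) ` {..<if w = [] then Suc d else d}"
    using assms by (auto simp: children_def child_in_verts_iff)
  then show ?thesis using True by (simp add: card_image inj_on_def)
qed (simp add: children_def child_in_verts_iff)

sublocale hardcore_graph "tree_edges (Suc d) h" lam
  by unfold_locales (auto simp: tree_edges_def fugacity_pos)

lemma nbrs_eq: "nbrs w = children w \<union> {u. w \<in> children u}"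
proof -
  have "{u, w} \<in> tree_edges (Suc d) h \<longleftrightarrow> (\<exists>v c. {u, w} = {v, v @ [c]} \<and> v @ [c] \<in> V)" for u
    unfolding tree_edges_def mem_Collect_eq ..
  then have "u \<in> nbrs w \<longleftrightarrow> u \<in> children w \<or> w \<in> children u" for u
    by (auto simp: nbrs_def children_def doubleton_eq_iff)
  then show ?thesis by auto
qed

lemma degree_le:
  assumes w: "w \<in> V"
  shows "degree V w \<le> Suc d"
proof (cases "w = []")
  case True
  then have "V \<inter> nbrs w = children w" by (auto simp: nbrs_eq children_def)
  then show ?thesis using card_children[OF w] by (simp add: degree_def)
next
  case False
  have "finite (children w)"
    using finite_tree_verts by (rule rev_finite_subset) (auto simp: children_def)
  then have "degree V w \<le> card (insert (butlast w) (children w))"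
    unfolding degree_def by (intro card_mono) (auto simp: nbrs_eq children_def)
  also have "\<dots> \<le> Suc (card (children w))" by (rule card_insert_le_m1) simp_all
  finally show ?thesis using card_children[OF w] False by (auto split: if_splits)
qed

definition full_branch :: "nat list set \<Rightarrow> nat list \<Rightarrow> bool" where
  "full_branch U w \<longleftrightarrow>
    w \<in> V \<and> U \<subseteq> V \<and> (\<forall>z. w @ z \<in> V \<longrightarrow> w @ z \<in> U) \<and> (\<forall>u\<in>U. w \<notin> children u)"

abbreviation alternating_influence :: "nat list set \<Rightarrow> nat list \<Rightarrow> real" where
  "alternating_influence \<equiv> weighted_influence (\<lambda>j. (-1) ^ length j)"

lemma full_branchD:
  assumes "full_branch U w"
  shows "finite U" "w \<in> U" "w \<in> V"
  using assms finite_tree_verts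
  by (auto simp: full_branch_def intro: finite_subset dest: spec[of _ "[]"])

lemma full_branch_root: "full_branch V []"
  using root_in_verts by (simp add: full_branch_def children_def)

lemma full_branch_nbrs: "full_branch U w \<Longrightarrow> U \<inter> nbrs w = children w"
  by (auto simp: full_branch_def nbrs_eq children_def)

lemma full_branch_pruned:
  assumes branch: "full_branch U w" and u: "u \<in> children w"
  shows "full_branch (pruned U w u) u"
proof -
  have mem: "u \<in> pruned U w u"
    using u full_branch_nbrs[OF branch] by (intro mem_pruned) simp
  have "u @ z \<in> pruned U w u" if z: "u @ z \<in> V" for z
  proof (cases "z = []")
    case False
    obtain c where "u = w @ [c]" using u by (auto simp: children_def)
    then have "u @ z \<in> U - {w} - nbrs w"
      using z False branch by (auto simp: full_branch_def nbrs_eq children_def)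
    then show ?thesis using Diff_nbrs_subset_pruned by blast
  qed (use mem in simp)
  then show ?thesis
    using branch u pruned_subset[of U w u] by (auto simp: full_branch_def children_def)
qed

lemma marg_full_branch:
  assumes branch: "full_branch U w"
    and children: "\<And>u. u \<in> children w \<Longrightarrow> marg (pruned U w u) u = x"
  shows "marg U w = hardcore_F (card (children w)) lam x"
  using marg_recursion[OF full_branchD(1,2)[OF branch]] children
  by (simp add: full_branch_nbrs[OF branch] hardcore_F_def)

lemma alternating_influence_full_branch:
  assumes branch: "full_branch U w"
    and children: "\<And>u. u \<in> children w \<Longrightarrow> marg (pruned U w u) u = x"
      "\<And>u. u \<in> children w \<Longrightarrow> alternating_influence (pruned U w u) u = (-1) ^ length u * a"
  shows "alternating_influence U w = (-1) ^ length w * (1 + real (card (children w)) * (x * a))"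
proof -
  have "marg (pruned U w u) u * alternating_influence (pruned U w u) u = - ((-1) ^ length w * (x * a))"
    if "u \<in> children w" for u
    using children[OF that] childrenD[OF that] by simp
  then show ?thesis
    by (simp add: weighted_influence_recursion[OF full_branchD(1,2)[OF branch]]
        full_branch_nbrs[OF branch] distrib_left mult_ac)
qed

lemma full_branch_values:
  assumes "full_branch U w" "w \<noteq> []" "length w + n = h"
  shows "marg U w = branch_marg d lam n \<and>
    alternating_influence U w = (-1) ^ length w * branch_influence d lam n"
  using assms
proof (induction n arbitrary: U w)
  case 0
  then have "children w = {}" by (auto simp: children_def child_in_verts_iff)
  then show ?case
    using marg_full_branch[OF "0.prems"(1), of 0] alternating_influence_full_branch[OF "0.prems"(1), of 0 0]
    by (simp add: branch_marg_def hardcore_F_def)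
next
  case (Suc n)
  have IH: "marg (pruned U w u) u = branch_marg d lam n"
    "alternating_influence (pruned U w u) u = (-1) ^ length u * branch_influence d lam n"
    if u: "u \<in> children w" for u
    using Suc.IH[OF full_branch_pruned[OF Suc.prems(1) u]] Suc.prems(3) childrenD[OF u] by auto
  have "card (children w) = d"
    using card_children[OF full_branchD(3)] Suc.prems by simp
  then show ?case
    using marg_full_branch[OF Suc.prems(1) IH(1)] alternating_influence_full_branch[OF Suc.prems(1) IH]
    by (simp add: branch_marg_def mult.assoc)
qed

lemma total_influence_root_ge:
  assumes h: "h = Suc n"
  shows "1 + real (Suc d) * (branch_marg d lam n * branch_influence d lam n) \<le> total_influence V []"
proof -
  have children: "marg (pruned V [] u) u = branch_marg d lam n"
    "alternating_influence (pruned V [] u) u = (-1) ^ length u * branch_influence d lam n"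
    if u: "u \<in> children []" for u
    using full_branch_values[OF full_branch_pruned[OF full_branch_root u], of n] childrenD[OF u] h
    by auto
  have "1 + real (Suc d) * (branch_marg d lam n * branch_influence d lam n) = alternating_influence V []"
    using alternating_influence_full_branch[OF full_branch_root children] card_children[OF root_in_verts] h
    by simp
  also have "\<dots> \<le> total_influence V []"
    by (rule abs_le_D1[OF abs_weighted_influence_le_total]) (simp add: power_abs)
  finally show ?thesis .
qed

end

section \<open>The limit of the spectral independence constants\<close>

context subcritical_fugacity
begin

lemma linf_SI_constant_tree_tendsto:
  assumes "x \<in> {0..1}" "hardcore_F d lam x = x"
  shows "(\<lambda>h. linf_SI_constant (tree_verts (Suc d) h) (hardcore (tree_verts (Suc d) h) (tree_edges (Suc d) h) lam))
    \<longlonglongrightarrow> (1 + x) / (1 - real d * x)"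
proof -
  interpret stable_fixed_point d lam x using assms by (rule stable_fixed_pointI)
  let ?C = "\<lambda>h. linf_SI_constant (tree_verts (Suc d) h)
    (hardcore (tree_verts (Suc d) h) (tree_edges (Suc d) h) lam)"
  let ?L = "\<lambda>n. 1 + real (Suc d) * (branch_marg d lam n * branch_influence d lam n)"
  have lower: "?L n \<le> ?C (Suc n)" for n
  proof -
    interpret hardcore_tree d "Suc n" lam by unfold_locales (rule fugacity_pos)
    show ?thesis
      using total_influence_root_ge[OF refl] total_influence_le_linf_SI_constant[OF finite_tree_verts root_in_verts]
      by linarith
  qed
  have upper: "?C h \<le> (1 + x) / (1 - real d * x)" for h
  proof -
    interpret hardcore_tree d h lam by unfold_locales (rule fugacity_pos)
    interpret stable_hardcore_graph "tree_edges (Suc d) h" lam x d by unfold_locales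
    show ?thesis using finite_tree_verts degree_le by (rule linf_SI_constant_le)
  qed
  have "branch_marg d lam \<longlonglongrightarrow> x"
    unfolding branch_marg_def[abs_def] using hardcore_F_iterates_tendsto[OF assms] by (rule LIMSEQ_Suc)
  then have "?L \<longlonglongrightarrow> 1 + real (Suc d) * (x * (1 / (1 - real d * x)))"
    using branch_influence_tendsto by (intro tendsto_intros)
  also have "1 + real (Suc d) * (x * (1 / (1 - real d * x))) = (1 + x) / (1 - real d * x)"
    using stable by (simp add: field_simps)
  finally have "(\<lambda>n. ?C (Suc n)) \<longlonglongrightarrow> (1 + x) / (1 - real d * x)"
    by (rule tendsto_sandwich[rotated 2, OF _ tendsto_const]) (use lower upper in auto)
  then show ?thesis by (rule LIMSEQ_imp_Suc)
qed

end

theorem theorem3p2: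
  fixes \<Delta> d :: nat and \<delta> lam :: real
  assumes "\<Delta> = d + 1" and "\<Delta> \<ge> 3"
    and "0 < \<delta>" and "\<delta> < 1"
    and "lam = (1 - \<delta>) * lambda_c \<Delta>"
  shows "(\<exists>!x. x \<in> {0..1} \<and> hardcore_F d lam x = x) \<and>
    (\<forall>xhat\<in>{0..1}. hardcore_F d lam xhat = xhat \<longrightarrow>
      (\<lambda>h. linf_SI_constant (tree_verts \<Delta> h) (hardcore (tree_verts \<Delta> h) (tree_edges \<Delta> h) lam))
        \<longlonglongrightarrow> (1 + xhat) / (1 - real d * xhat))"
proof -
  have \<Delta>: "\<Delta> = Suc d" and d: "2 \<le> d" using assms by auto
  interpret subcritical_fugacity d lam
    using assms(3-5) d lambda_c_pos[OF d] by unfold_locales (auto simp: \<Delta>)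
  show ?thesis
    unfolding \<Delta> using ex1_hardcore_F_fixed_point linf_SI_constant_tree_tendsto by blast
qed

end
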